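(* Suppose an unanticipated automation shock at date $\tau$ expands the measure of automatable tasks from $I$ to $I+\Delta$, where $\Delta>0$ and $N-I-\Delta>1$. Let $\{Y_t\}_{t\ge\tau}$ and $\{\tilde Y_t\}_{t\ge\tau}$ be equilibrium aggregate output without and with the shock, as defined in the context. Then: 1. (Immediate adoption gains) $\tilde Y_\tau>Y_\tau$. 2. (Permanent growth slowdown) The growth rate of output is strictly lower at all dates: for all $t\ge\tau$, $\tilde Y_{t+1}/\tilde Y_t=1+\tilde g<1+g=Y_{t+1}/Y_t$, where $1+\tilde g=(N-I-\Delta)^\theta$ and $1+g=(N-I)^\theta$. 3. (Long-run reversal) There exists a date $t^*>\tau$ such that $\tilde Y_t<Y_t$ for all $t>t^*$.
   Context: Parameters: $\beta\in(0,1)$, $\rho>0$, $m>h>0$, $0<I<N$, $N-I>1$, $\theta\in(0,1)$, with $\beta(N-I)^\theta<1$. At the shock date $\tau$ the CDF of expert skills is exactly Pareto with scale $x_\tau$ and shape $1/\theta$: $F_\tau(q)=1-(q/x_\tau)^{-1/\theta}$ for $q\ge x_\tau$, where $x_\tau>\frac{\rho I}{h^N[(m/h)^I-1]}$ (which guarantees that all active experts automate all automatable tasks, both before and after the shock). Equilibrium allocations with span of control $\ell>1$ (number of novices hired by each active expert, who all inherit her skill) starting from $F_\tau$: the sequences $\{a_t,F_t\}_{t\ge\tau}$ determined by $1=\ell[1-F_t(a_t)]$ and $F_{t+1}(q)=0$ if $q\le a_t$, $F_{t+1}(q)=\ell[F_t(q)-F_t(a_t)]$ if $q>a_t$. No shock: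 $\{a_t,F_t\}_{t\ge\tau}$ are the allocations with $\ell=N-I$, and $Y_t=m^Ih^{N-I}\int_{a_t}^\infty q\,dF_t(q)$. Shock: $\{\tilde a_t,\tilde F_t\}_{t\ge\tau}$ are the allocations with $\ell=N-I-\Delta$ starting from the same $\tilde F_\tau=F_\tau$, and $\tilde Y_t=m^{I+\Delta}h^{N-I-\Delta}\int_{\tilde a_t}^\infty q\,d\tilde F_t(q)$. *)

theory Defs
  imports "HOL-Analysis.Analysis"
begin

definition pareto_cdf :: "real \<Rightarrow> real \<Rightarrow> real \<Rightarrow> real" where
  "pareto_cdf x \<theta> q = (if x \<le> q then 1 - (q / x) powr (- 1 / \<theta>) else 0)"

text \<open>
  Allocations from date \<open>\<tau>\<close> on, with span of control \<open>l\<close> and initial skill CDF \<open>F0\<close>: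
  \<open>a t\<close> is the skill of the marginal active expert and \<open>F t\<close> the CDF of expert skills
  at date \<open>t\<close>. Values of \<open>a\<close> and \<open>F\<close> before \<open>\<tau>\<close> are unconstrained.
\<close>

definition equilibrium_allocations ::
    "real \<Rightarrow> nat \<Rightarrow> (real \<Rightarrow> real) \<Rightarrow> (nat \<Rightarrow> real) \<Rightarrow> (nat \<Rightarrow> real \<Rightarrow> real) \<Rightarrow> bool" where
  "equilibrium_allocations l \<tau> F0 a F \<longleftrightarrow>
     F \<tau> = F0 \<and>
     (\<forall>t\<ge>\<tau>. 1 = l * (1 - F t (a t)) \<and>
       (\<forall>q. F (Suc t) q = (if q \<le> a t then 0 else l * (F t q - F t (a t)))))"

text \<open>
  Aggregate output when tasks of measure \<open>I\<close> out of \<open>N\<close> are automatable (productivity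
  \<open>m\<close> on automated tasks, \<open>h\<close> on the others). The integral against the CDF is the
  Lebesgue--Stieltjes integral; for allocations starting from a Pareto CDF every \<open>F t\<close> is
  continuous, so including the endpoint \<open>a t\<close> is immaterial, and \<open>\<theta> < 1\<close> makes the
  integral finite.
\<close>

definition aggregate_output ::
    "real \<Rightarrow> real \<Rightarrow> real \<Rightarrow> real \<Rightarrow> (nat \<Rightarrow> real) \<Rightarrow> (nat \<Rightarrow> real \<Rightarrow> real) \<Rightarrow> nat \<Rightarrow> real" where
  "aggregate_output m h N I a F t =
     m powr I * h powr (N - I) * (LINT q:{a t..}|interval_measure (F t). q)"

end

theory Submission
  imports Defs "HOL-Probability.Distribution_Functions" "HOL-Real_Asymp.Real_Asymp"
begin

text \<open>
  A Pareto distribution truncated at its \<open>1 / l\<close> upper quantile and rescaled is again Pareto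
  with the same shape, so every \<open>F t\<close> is Pareto and only the scale changes, by the factor
  \<open>l powr \<theta>\<close> per period. With automated measure \<open>J\<close> and \<open>l = N - J\<close>, output is therefore a geometric sequence with ratio
  \<open>l powr \<theta>\<close> and initial value \<open>m powr J * h powr l * x * l powr (\<theta> - 1) / (1 - \<theta>)\<close>. Raising
  \<open>J\<close> raises the initial value (as \<open>m > h\<close> and \<open>\<theta> < 1\<close>) and lowers the
  ratio.
\<close>

section \<open>Pareto laws: distribution function, density and tail expectation\<close>

text \<open>Serves two exponents: \<open>s = 1 / \<theta>\<close> gives the total mass of the Pareto
  density, \<open>s = 1 / \<theta> - 1\<close> its tail expectation.\<close>

lemma nn_integral_powr_atLeast:
  fixes c s :: real
  assumes "0 < c" "0 < s"
  shows "(\<integral>\<^sup>+q. ennreal (q powr (- s - 1)) * indicator {c..} q \<partial>lborel) = ennreal (c powr (- s) / s)"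
proof -
  have "(\<integral>\<^sup>+q. ennreal (q powr (- s - 1)) * indicator {c..} q \<partial>lborel)
      = ennreal (0 - (- (c powr (- s) / s)))"
  proof (rule nn_integral_FTC_atLeast)
    fix q assume "c \<le> q"
    then have "0 < q" using assms by simp
    then show "((\<lambda>q. - (q powr (- s) / s)) has_real_derivative q powr (- s - 1)) (at q)"
      using assms by (auto intro!: derivative_eq_intros simp: field_simps)
  next
    show "((\<lambda>q. - (q powr (- s) / s)) \<longlongrightarrow> 0) at_top"
      using assms by real_asymp
  qed auto
  then show ?thesis by simp
qed

lemma pareto_cdf_nonneg:
  assumes "0 < x" "0 < \<theta>"
  shows "0 \<le> pareto_cdf x \<theta> q"
proof (cases "x \<le> q")
  case True
  then have "(q / x) powr (- 1 / \<theta>) \<le> (q / x) powr 0"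
    using assms by (intro powr_mono) auto
  then show ?thesis using True assms by (auto simp: pareto_cdf_def)
qed (simp add: pareto_cdf_def)

lemma pareto_cdf_mono:
  assumes "0 < x" "0 < \<theta>" "p \<le> q"
  shows "pareto_cdf x \<theta> p \<le> pareto_cdf x \<theta> q"
proof (cases "x \<le> p")
  case True
  then have "(q / x) powr (- 1 / \<theta>) \<le> (p / x) powr (- 1 / \<theta>)"
    using assms by (intro powr_mono2') (auto simp: divide_right_mono)
  then show ?thesis using True assms by (auto simp: pareto_cdf_def)
next
  case False
  then show ?thesis using pareto_cdf_nonneg[OF assms(1,2), of q] by (simp add: pareto_cdf_def)
qed

lemma isCont_pareto_cdf:
  assumes "0 < x" "0 < \<theta>"
  shows "isCont (pareto_cdf x \<theta>) q"
proof -
  \<comment> \<open>Using \<open>max q x\<close> absorbs the case split and keeps the base of the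
    power at least 1, where \<open>powr\<close> is continuous.\<close>
  have "pareto_cdf x \<theta> = (\<lambda>q. 1 - (max q x / x) powr (- 1 / \<theta>))"
    using assms by (auto simp: pareto_cdf_def max_def fun_eq_iff)
  moreover have "isCont (\<lambda>q. 1 - (max q x / x) powr (- 1 / \<theta>)) q"
    using assms by (intro continuous_intros) (auto simp: max_def)
  ultimately show ?thesis by simp
qed

text \<open>The derivative of the CDF above \<open>x\<close>, with the powers of \<open>x\<close>
  collected in a constant factor so that integrals reduce to pure powers of
  \<open>q\<close>.\<close>

definition pareto_density :: "real \<Rightarrow> real \<Rightarrow> real \<Rightarrow> real" where
  "pareto_density x \<theta> q = x powr (1 / \<theta>) / \<theta> * q powr (- 1 / \<theta> - 1) * indicator {x..} q"

lemma borel_measurable_pareto_density [measurable]: "pareto_density x \<theta> \<in> borel_measurable borel"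
  unfolding pareto_density_def by measurable

lemma nn_integral_pareto_density_Iic:
  assumes "0 < x" "0 < \<theta>"
  shows "(\<integral>\<^sup>+q. ennreal (pareto_density x \<theta> q) * indicator {..b} q \<partial>lborel)
    = ennreal (pareto_cdf x \<theta> b)"
proof (cases "x \<le> b")
  case False
  then have "(\<integral>\<^sup>+q. ennreal (pareto_density x \<theta> q) * indicator {..b} q \<partial>lborel)
    = (\<integral>\<^sup>+(q::real). 0 \<partial>lborel)"
    by (intro nn_integral_cong) (auto simp: pareto_density_def indicator_def)
  then show ?thesis using False by (simp add: pareto_cdf_def)
next
  case True
  let ?f = "\<lambda>q. x powr (1 / \<theta>) / \<theta> * q powr (- 1 / \<theta> - 1)"
  \<comment> \<open>On \<open>{x..b}\<close> this antiderivative is the CDF minus 1; in particular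
    \<open>?G x = - 1\<close>.\<close>
  let ?G = "\<lambda>q. - (x powr (1 / \<theta>) * q powr (- 1 / \<theta>))"
  have "(\<integral>\<^sup>+q. ennreal (pareto_density x \<theta> q) * indicator {..b} q \<partial>lborel)
      = (\<integral>\<^sup>+q. ennreal (?f q) * indicator {x..b} q \<partial>lborel)"
    by (intro nn_integral_cong) (auto simp: pareto_density_def indicator_def)
  also have "\<dots> = ennreal (?G b - ?G x)"
  proof (rule nn_integral_FTC_Icc)
    fix q assume "q \<in> {x..b}"
    then have "0 < q" using assms by simp
    then show "(?G has_real_derivative ?f q) (at q)"
      using assms by (auto intro!: derivative_eq_intros simp: field_simps)
  qed (use assms True in auto)
  also have "?G b - ?G x = pareto_cdf x \<theta> b"
    using assms True
    by (simp add: pareto_cdf_def powr_divide powr_minus field_simps flip: powr_add)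
  finally show ?thesis .
qed

text \<open>Turns the Stieltjes integral in aggregate output into a Lebesgue integral with a
  density. Both measures are probability distributions on the line with the same CDF.\<close>

lemma interval_measure_pareto:
  assumes "0 < x" "0 < \<theta>"
  shows "interval_measure (pareto_cdf x \<theta>) = density lborel (pareto_density x \<theta>)"
proof (rule cdf_unique)
  have bot: "(pareto_cdf x \<theta> \<longlongrightarrow> 0) at_bot"
    by (rule tendsto_eventually)
       (auto simp: pareto_cdf_def eventually_at_bot_linorder intro!: exI[of _ "x - 1"])
  have "((\<lambda>q. 1 - (q / x) powr (- 1 / \<theta>)) \<longlongrightarrow> 1) at_top"
    using assms by real_asymp
  then have top: "(pareto_cdf x \<theta> \<longlongrightarrow> 1) at_top"
    by (rule Lim_transform_eventually)
       (auto simp: pareto_cdf_def eventually_at_top_linorder intro!: exI[of _ x])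
  have cont: "continuous (at_right q) (pareto_cdf x \<theta>)" for q
    using isCont_pareto_cdf[OF assms] by (rule continuous_at_imp_continuous_at_within)
  show "real_distribution (interval_measure (pareto_cdf x \<theta>))"
    using pareto_cdf_mono[OF assms] cont bot top by (rule real_distribution_interval_measure)
  \<comment> \<open>Total mass 1 is the case \<open>c = x\<close>, \<open>s = 1 / \<theta>\<close>
    of the power integral, where the powers of \<open>x\<close> cancel.\<close>
  have "(\<integral>\<^sup>+q. ennreal (pareto_density x \<theta> q) \<partial>lborel)
      = (\<integral>\<^sup>+q. ennreal (x powr (1 / \<theta>) / \<theta>) *
          (ennreal (q powr (- (1 / \<theta>) - 1)) * indicator {x..} q) \<partial>lborel)"
    using assms
    by (intro nn_integral_cong) (auto simp: pareto_density_def indicator_def simp flip: ennreal_mult')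
  also have "\<dots> = ennreal (x powr (1 / \<theta>) / \<theta>) * ennreal (x powr (- (1 / \<theta>)) / (1 / \<theta>))"
    using assms by (simp add: nn_integral_cmult nn_integral_powr_atLeast)
  also have "\<dots> = 1"
    using assms by (simp flip: ennreal_mult' powr_add)
  finally have "prob_space (density lborel (pareto_density x \<theta>))"
    by (intro prob_spaceI) (simp add: emeasure_density)
  then show "real_distribution (density lborel (pareto_density x \<theta>))"
    by (simp add: real_distribution_def real_distribution_axioms_def)
  have "cdf (interval_measure (pareto_cdf x \<theta>)) = pareto_cdf x \<theta>"
    using pareto_cdf_mono[OF assms] cont bot by (rule cdf_interval_measure)
  moreover have "cdf (density lborel (pareto_density x \<theta>)) q = pareto_cdf x \<theta> q" for q
    using assms
    by (simp add: cdf_def measure_def emeasure_density nn_integral_pareto_density_Iic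
        pareto_cdf_nonneg)
  ultimately show "cdf (interval_measure (pareto_cdf x \<theta>)) = cdf (density lborel (pareto_density x \<theta>))"
    by (simp add: fun_eq_iff)
qed

lemma pareto_tail_expectation:
  assumes "0 < x" "0 < \<theta>" "\<theta> < 1" "x \<le> c"
  shows "(LINT q:{c..}|interval_measure (pareto_cdf x \<theta>). q)
    = x powr (1 / \<theta>) * c powr (1 - 1 / \<theta>) / (1 - \<theta>)"
proof -
  let ?M = "density lborel (pareto_density x \<theta>)"
  \<comment> \<open>Weighting the density by \<open>q\<close> raises its exponent to
    \<open>- 1 / \<theta> = - s - 1\<close>; \<open>\<theta> < 1\<close> makes \<open>s\<close>
    positive and the tail integrable.\<close>
  define s where "s = 1 / \<theta> - 1"
  have s: "0 < s" "\<theta> * s = 1 - \<theta>" using assms by (auto simp: s_def field_simps)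
  have "(LINT q:{c..}|interval_measure (pareto_cdf x \<theta>). q)
      = (LINT q|?M. indicator {c..} q *\<^sub>R q)"
    using assms by (simp add: set_lebesgue_integral_def interval_measure_pareto)
  \<comment> \<open>The integrand is nonnegative because \<open>0 < x \<le> c\<close>.\<close>
  also have "\<dots> = enn2real (\<integral>\<^sup>+q. ennreal (indicator {c..} q *\<^sub>R q) \<partial>?M)"
    using assms by (intro integral_eq_nn_integral AE_I2) (auto simp: indicator_def)
  also have "(\<integral>\<^sup>+q. ennreal (indicator {c..} q *\<^sub>R q) \<partial>?M)
      = (\<integral>\<^sup>+q. ennreal (pareto_density x \<theta> q) * ennreal (indicator {c..} q *\<^sub>R q) \<partial>lborel)"
    by (subst nn_integral_density) auto
  also have "\<dots> = (\<integral>\<^sup>+q. ennreal (x powr (1 / \<theta>) / \<theta>) *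
      (ennreal (q powr (- s - 1)) * indicator {c..} q) \<partial>lborel)"
  proof (intro nn_integral_cong)
    fix q :: real
    show "ennreal (pareto_density x \<theta> q) * ennreal (indicator {c..} q *\<^sub>R q)
      = ennreal (x powr (1 / \<theta>) / \<theta>) * (ennreal (q powr (- s - 1)) * indicator {c..} q)"
    proof (cases "c \<le> q")
      case True
      then have "q powr (- s - 1) = q powr (- 1 / \<theta> - 1) * q"
        using assms powr_add[of q "- 1 / \<theta> - 1" 1] by (simp add: s_def)
      then show ?thesis
        using True assms by (simp add: pareto_density_def mult.assoc flip: ennreal_mult')
    qed simp
  qed
  also have "\<dots> = ennreal (x powr (1 / \<theta>) / \<theta>) * ennreal (c powr (- s) / s)"
    using assms s by (simp add: nn_integral_cmult nn_integral_powr_atLeast)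
  also have "\<dots> = ennreal (x powr (1 / \<theta>) * c powr (- s) / (\<theta> * s))"
    using assms s by (simp flip: ennreal_mult')
  finally show ?thesis
    using assms s by (simp add: s_def)
qed

section \<open>Truncation and the dynamics of the skill distribution\<close>

lemma pareto_quantile:
  assumes "0 < x" "0 < \<theta>" "1 < l" "1 = l * (1 - pareto_cdf x \<theta> c)"
  shows "c = x * l powr \<theta>"
proof -
  \<comment> \<open>Below \<open>x\<close> the CDF is 0, and the quantile condition would read
    \<open>1 = l\<close>.\<close>
  have c: "x \<le> c" using assms by (auto simp: pareto_cdf_def split: if_splits)
  then have "(c / x) powr (- 1 / \<theta>) = 1 / l"
    using assms by (auto simp: pareto_cdf_def field_simps)
  then have "((c / x) powr (- 1 / \<theta>)) powr (- \<theta>) = (1 / l) powr (- \<theta>)"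
    by simp
  then have "c / x = l powr \<theta>"
    using assms c by (simp add: powr_powr powr_divide powr_minus)
  then show ?thesis using assms by (simp add: field_simps)
qed

text \<open>The survival function is a power law, so multiplying it by \<open>l\<close> amounts to
  rescaling its argument: with \<open>c = x * l powr \<theta>\<close>, the factor \<open>l\<close>
  turns \<open>(q / x) powr (- 1 / \<theta>)\<close> into
  \<open>(q / c) powr (- 1 / \<theta>)\<close>.\<close>

lemma pareto_selection:
  assumes "0 < x" "0 < \<theta>" "1 < l" "1 = l * (1 - pareto_cdf x \<theta> c)"
  shows "(if q \<le> c then 0 else l * (pareto_cdf x \<theta> q - pareto_cdf x \<theta> c)) = pareto_cdf c \<theta> q"
proof (cases "q \<le> c")
  case True
  \<comment> \<open>At the endpoint \<open>q = c\<close> the Pareto formula applies and must give 0,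
    which uses \<open>c / c = 1\<close>.\<close>
  have "0 < c" using assms pareto_quantile[OF assms] by simp
  then show ?thesis using True by (auto simp: pareto_cdf_def)
next
  case False
  have c: "c = x * l powr \<theta>" by (rule pareto_quantile[OF assms])
  moreover have "1 \<le> l powr \<theta>" using assms by (simp add: ge_one_powr_ge_zero)
  ultimately have xc: "x \<le> c" using assms by simp
  have "(q / c) powr (- 1 / \<theta>) = l * (q / x) powr (- 1 / \<theta>)"
  proof -
    have "q / c = (q / x) * l powr (- \<theta>)"
      by (simp add: c powr_minus field_simps)
    then have "(q / c) powr (- 1 / \<theta>) = (q / x) powr (- 1 / \<theta>) * (l powr (- \<theta>)) powr (- 1 / \<theta>)"
      by (simp only: powr_mult)
    then show ?thesis using assms by (simp add: powr_powr)
  qed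
  moreover have "l * (pareto_cdf x \<theta> q - pareto_cdf x \<theta> c) = 1 - l * (1 - pareto_cdf x \<theta> q)"
    using assms(4) by (simp add: algebra_simps)
  ultimately show ?thesis using False xc by (simp add: pareto_cdf_def)
qed

text \<open>The cutoff of each period is the Pareto scale of the next one, and the cutoff is
  \<open>l powr \<theta>\<close> times the current scale.\<close>

lemma equilibrium_allocations_pareto:
  assumes eq: "equilibrium_allocations l \<tau> (pareto_cdf x \<theta>) a F"
    and "0 < x" "0 < \<theta>" "1 < l"
  shows "F (\<tau> + k) = pareto_cdf (x * (l powr \<theta>) ^ k) \<theta>"
proof (induction k)
  case 0
  then show ?case using eq by (simp add: equilibrium_allocations_def)
next
  case (Suc k)
  let ?x = "x * (l powr \<theta>) ^ k"
  have x: "0 < ?x" using assms by simp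
  have q: "1 = l * (1 - pareto_cdf ?x \<theta> (a (\<tau> + k)))"
    using eq Suc.IH by (metis equilibrium_allocations_def le_add1)
  have "F (Suc (\<tau> + k)) p
      = (if p \<le> a (\<tau> + k) then 0 else l * (F (\<tau> + k) p - F (\<tau> + k) (a (\<tau> + k))))" for p
    using eq by (simp add: equilibrium_allocations_def)
  then have "F (Suc (\<tau> + k)) p = pareto_cdf (a (\<tau> + k)) \<theta> p" for p
    by (simp only: Suc.IH pareto_selection[OF x assms(3,4) q])
  then show ?case
    using pareto_quantile[OF x _ _ q] assms(3,4) by (simp add: fun_eq_iff mult_ac)
qed

section \<open>Aggregate output and its comparison across regimes\<close>

lemma aggregate_output_pareto:
  assumes eq: "equilibrium_allocations (N - J) \<tau> (pareto_cdf x \<theta>) a F"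
    and "0 < x" "0 < \<theta>" "\<theta> < 1" "1 < N - J"
  shows "aggregate_output m h N J a F (\<tau> + k)
    = m powr J * h powr (N - J) * (x * (N - J) powr (\<theta> - 1) / (1 - \<theta>)) * ((N - J) powr \<theta>) ^ k"
proof -
  define l where "l = N - J"
  let ?x = "x * (l powr \<theta>) ^ k"
  have l: "1 < l" using assms by (simp add: l_def)
  have x: "0 < ?x" using assms l by simp
  have F: "F (\<tau> + k) = pareto_cdf ?x \<theta>"
    using equilibrium_allocations_pareto[OF eq] assms by (simp add: l_def)
  then have "1 = l * (1 - pareto_cdf ?x \<theta> (a (\<tau> + k)))"
    using eq by (metis equilibrium_allocations_def l_def le_add1)
  then have a: "a (\<tau> + k) = ?x * l powr \<theta>"
    using x l assms by (intro pareto_quantile)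
  have "1 \<le> l powr \<theta>" using l assms by (simp add: ge_one_powr_ge_zero)
  \<comment> \<open>The tail formula holds only for cutoffs at or above the scale.\<close>
  then have "?x \<le> a (\<tau> + k)" by (simp only: a mult_le_cancel_left1) (use x in simp)
  then have "(LINT q:{a (\<tau> + k)..}|interval_measure (F (\<tau> + k)). q)
      = ?x powr (1 / \<theta>) * (?x * l powr \<theta>) powr (1 - 1 / \<theta>) / (1 - \<theta>)"
    using x assms by (simp only: F pareto_tail_expectation a)
  also have "(?x * l powr \<theta>) powr (1 - 1 / \<theta>) = ?x powr (1 - 1 / \<theta>) * l powr (\<theta> - 1)"
    using x l assms by (simp add: powr_mult powr_powr algebra_simps)
  \<comment> \<open>The exponents of \<open>?x\<close> add up to 1: output is linear in the scale
    and inherits its geometric growth.\<close>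
  also have "?x powr (1 / \<theta>) * (?x powr (1 - 1 / \<theta>) * l powr (\<theta> - 1)) = ?x * l powr (\<theta> - 1)"
    using x by (simp flip: powr_add mult.assoc)
  finally show ?thesis
    by (simp add: aggregate_output_def mult_ac flip: l_def)
qed

text \<open>After division by \<open>r ^ k\<close> the left side is a multiple of
  \<open>(s / r) ^ k\<close>, which tends to 0, while the right side stays at
  \<open>A > 0\<close>.\<close>

lemma geometric_eventually_less:
  fixes A B r s :: real
  assumes "0 < A" "0 < s" "s < r"
  shows "\<forall>\<^sub>F k in sequentially. B * s ^ k < A * r ^ k"
proof -
  have "(\<lambda>k. B * (s / r) ^ k) \<longlonglongrightarrow> B * 0"
    using assms by (intro tendsto_mult_left LIMSEQ_realpow_zero) auto
  then have "\<forall>\<^sub>F k in sequentially. B * (s / r) ^ k < A"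
    using assms by (intro order_tendstoD(2)[of _ "B * 0"]) auto
  then show ?thesis
    by eventually_elim (use assms in \<open>simp add: power_divide field_simps\<close>)
qed

theorem proposition4:
  fixes \<beta> \<rho> m h I N \<theta> \<Delta> x g g' :: real
    and \<tau> :: nat
    and a a' :: "nat \<Rightarrow> real"
    and F F' :: "nat \<Rightarrow> real \<Rightarrow> real"
    and Y Y' :: "nat \<Rightarrow> real"
  assumes "0 < \<beta>" "\<beta> < 1" "0 < \<rho>" "0 < h" "h < m"
    and "0 < I" "I < N" "1 < N - I"
    and "0 < \<theta>" "\<theta> < 1" "\<beta> * (N - I) powr \<theta> < 1"
    and "\<rho> * I / (h powr N * ((m / h) powr I - 1)) < x"
    and "0 < \<Delta>" "1 < N - I - \<Delta>"
    and "equilibrium_allocations (N - I) \<tau> (pareto_cdf x \<theta>) a F"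
    and "equilibrium_allocations (N - I - \<Delta>) \<tau> (pareto_cdf x \<theta>) a' F'"
    and "\<And>t. t \<ge> \<tau> \<Longrightarrow> Y t = aggregate_output m h N I a F t"
    and "\<And>t. t \<ge> \<tau> \<Longrightarrow> Y' t = aggregate_output m h N (I + \<Delta>) a' F' t"
    and "1 + g = (N - I) powr \<theta>"
    and "1 + g' = (N - I - \<Delta>) powr \<theta>"
  shows "Y' \<tau> > Y \<tau>
    \<and> (\<forall>t\<ge>\<tau>. Y' (Suc t) / Y' t = 1 + g' \<and> 1 + g' < 1 + g \<and> 1 + g = Y (Suc t) / Y t)
    \<and> (\<exists>t'>\<tau>. \<forall>t>t'. Y' t < Y t)"
proof -
  note pos = assms(3-10) assms(13,14)
  define C where "C = m powr I * h powr (N - I) * (x * (N - I) powr (\<theta> - 1) / (1 - \<theta>))"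
  define C' where "C' = m powr (I + \<Delta>) * h powr (N - I - \<Delta>) *
    (x * (N - I - \<Delta>) powr (\<theta> - 1) / (1 - \<theta>))"
  define r where "r = (N - I) powr \<theta>"
  define r' where "r' = (N - I - \<Delta>) powr \<theta>"
  \<comment> \<open>The lower bound imposed on \<open>x\<close> is positive because
    \<open>h < m\<close>, so \<open>x\<close> is a genuine Pareto scale.\<close>
  have "1 < (m / h) powr I" using pos by (intro gr_one_powr) auto
  then have "0 < \<rho> * I / (h powr N * ((m / h) powr I - 1))" using pos by simp
  then have x: "0 < x" using assms(12) by linarith
  have Y: "Y (\<tau> + k) = C * r ^ k" for k
    using aggregate_output_pareto[OF assms(15) x] pos by (simp add: assms(17) C_def r_def)
  have Y': "Y' (\<tau> + k) = C' * r' ^ k" for k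
    using aggregate_output_pareto[of N "I + \<Delta>" \<tau> x \<theta> a' F' m h k] assms(16) x pos
    by (simp add: assms(18) C'_def r'_def diff_diff_eq)
  have C: "0 < C" using x pos by (simp add: C_def)
  have r': "0 < r'" "r' < r" using pos by (auto simp: r_def r'_def intro!: powr_less_mono2)
  \<comment> \<open>Two gains at date \<open>\<tau>\<close>: measure \<open>\<Delta>\<close> of
    tasks moves from productivity \<open>h\<close> to \<open>m\<close>, and the smaller span raises
    the total skill of active experts, since the exponent \<open>\<theta> - 1\<close> is
    negative.\<close>
  have "C < C'"
  proof -
    have "m powr I * h powr (N - I) = m powr I * h powr \<Delta> * h powr (N - I - \<Delta>)"
      using pos by (simp add: mult.assoc flip: powr_add)
    also have "\<dots> < m powr I * m powr \<Delta> * h powr (N - I - \<Delta>)"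
      using pos by (intro mult_strict_right_mono mult_strict_left_mono powr_less_mono2) auto
    also have "\<dots> = m powr (I + \<Delta>) * h powr (N - I - \<Delta>)"
      by (simp add: powr_add)
    finally have "m powr I * h powr (N - I) < m powr (I + \<Delta>) * h powr (N - I - \<Delta>)" .
    moreover have "(N - I) powr (\<theta> - 1) < (N - I - \<Delta>) powr (\<theta> - 1)"
      using pos by (intro powr_less_mono2_neg) auto
    then have "x * (N - I) powr (\<theta> - 1) / (1 - \<theta>) < x * (N - I - \<Delta>) powr (\<theta> - 1) / (1 - \<theta>)"
      using x pos by (intro divide_strict_right_mono mult_strict_left_mono) auto
    ultimately show ?thesis
      unfolding C_def C'_def
      by (rule mult_strict_mono) (use x pos in auto)
  qed
  then have "Y \<tau> < Y' \<tau>" using Y[of 0] Y'[of 0] by simp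
  moreover have "Y' (Suc t) / Y' t = 1 + g' \<and> 1 + g' < 1 + g \<and> 1 + g = Y (Suc t) / Y t"
    if "\<tau> \<le> t" for t
  proof -
    obtain k where t: "t = \<tau> + k" using le_Suc_ex[OF \<open>\<tau> \<le> t\<close>] by blast
    have "Y (Suc t) = r * Y t" "Y' (Suc t) = r' * Y' t"
      using Y[of "Suc k"] Y'[of "Suc k"] Y[of k] Y'[of k] by (simp_all add: t)
    \<comment> \<open>Division by zero has to be excluded before the recursions yield growth
      ratios.\<close>
    moreover have "Y t \<noteq> 0" "Y' t \<noteq> 0"
      using C \<open>C < C'\<close> r' by (simp_all add: t Y Y')
    ultimately show ?thesis
      using r'(2) by (simp add: assms(19,20) r_def r'_def)
  qed
  moreover have "\<exists>t'>\<tau>. \<forall>t>t'. Y' t < Y t"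
  proof -
    obtain K where K: "\<And>k. K \<le> k \<Longrightarrow> C' * r' ^ k < C * r ^ k"
      using geometric_eventually_less[OF C r'] unfolding eventually_sequentially by blast
    \<comment> \<open>\<open>K\<close> counts periods since \<open>\<tau>\<close> and may be 0; the
      extra 1 puts the reversal date strictly after \<open>\<tau>\<close>.\<close>
    have "Y' t < Y t" if "\<tau> + K + 1 < t" for t
      using K[of "t - \<tau>"] Y[of "t - \<tau>"] Y'[of "t - \<tau>"] that by simp
    then show ?thesis
      by (intro exI[of _ "\<tau> + K + 1"]) simp
  qed
  ultimately show ?thesis by blast
qed

end
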